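(* Let $e\ge 1$, $m\ge 0$ be integers, let $Y$ be a totally ordered set with $d=em+1$ elements and $\pi:Y\to\mathbb{N}$ a map all of whose fibres have at most $e$ elements, and let $E'$ and $\mathbb{S}'=(\mathbb{S}_{\xi_1,\xi_2})_{\xi_1,\xi_2\in E'}$ be as defined in the context. Choose $a_y\in\mathbb{Z}$, $1\le y\le r$, such that $$\xi_0=(a_1,\ldots,a_1+n_1-1)\otimes\cdots\otimes(a_r,\ldots,a_r+n_r-1)\in E'.$$ Then the structure constants $$N_{\xi_1,\xi_2}^{\xi_3}:=\sum_{\xi\in E'}\frac{\mathbb{S}'_{\xi,\xi_1}\,\mathbb{S}'_{\xi,\xi_2}\,\overline{\mathbb{S}'_{\xi,\xi_3}}}{\mathbb{S}'_{\xi,\xi_0}}$$ are integers for all $\xi_1,\xi_2,\xi_3\in E'$.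
   Context: Put $\zeta=\exp(2\pi \mathrm{i}/e)$. Let $\pi(Y)=\{w_1,\dots,w_r\}$ with $w_1,\dots,w_r$ distinct, and $n_\mu=|\pi^{-1}(w_\mu)|\le e$. Let $\Xi$ be the set of all maps $\psi:Y\to\{0,\dots,e-1\}$ such that $\psi(y)<\psi(y')$ whenever $y<y'$ and $\pi(y)=\pi(y')$. For $\psi\in\Xi$ put $\epsilon(\psi)=(-1)^{|\{(y,y')\in Y\times Y\,\mid\, y<y',\ \psi(y)<\psi(y')\}|}$. Identify $\psi\in\Xi$ with the symbol $\bar i^1\otimes\cdots\otimes\bar i^r$, where $\bar i^\mu=(i^\mu_1,\dots,i^\mu_{n_\mu})$, $0\le i_1^\mu<\dots<i^\mu_{n_\mu}\le e-1$, and $\{i_1^\mu,\dots,i_{n_\mu}^\mu\}=\psi(\pi^{-1}(w_\mu))$; let $E$ be the set of all such symbols (in bijection with $\Xi$). Put $c=(-1)^{m(e-1)}\,\mathrm{i}^{-\binom{e-1}{2}m}\sqrt{e}^{\,d-em}$. The matrix $\mathbb{S}$, indexed by $E\cong\Xi$, is defined, for $\psi_1=\bar i^1\otimes\cdots\otimes\bar i^r$ and $\psi_2=\bar j^1\otimes\cdots\otimes\bar j^r$, by $$\overline{\mathbb{S}_{\psi_1,\psi_2}}=\bar c\,\epsilon(\psi_1)\epsilon(\psi_2)\prod_{\mu=1}^r\ \sum_{\sigma\in S_{n_\mu}}\operatorname{sgn}(\sigma)\prod_{\nu=1}^{n_\mu}\frac{1}{\sqrt e}\,\zeta^{\,i^\mu_\nu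 j^\mu_{\sigma(\nu)}}.$$ Let $E'$ be the set of $\bar i^1\otimes\cdots\otimes\bar i^r\in E$ with $\sum_{\mu=1}^r\sum_{\nu=1}^{n_\mu} i^\mu_\nu\equiv m\binom{e}{2}\pmod e$, and $\mathbb{S}'=(\mathbb{S}_{\xi_1,\xi_2})_{\xi_1,\xi_2\in E'}$. These are the blocks of the Fourier matrices for the complex reflection groups $G(e,1,n)$. In the definition of $\xi_0$ the entries of each tuple are taken modulo $e$ and arranged in increasing order; the entries $\mathbb{S}'_{\xi,\xi_0}$ are non-zero (Vandermonde determinants up to non-zero factors). *)

theory Defs
  imports Complex_Main "HOL-Library.FuncSet" "HOL-Combinatorics.Permutations" "HOL-Number_Theory.Cong"
begin

text \<open>
  Throughout, \<open>p\<close> is the map written $\pi$ in the mathematics (\<open>pi\<close> is the number), and \<open>ws\<close> is an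
  enumeration without repetition $w_1,\dots,w_r$ of $\pi(Y)$, so that $r$ is \<open>length ws\<close>.
  All tuples are lists, hence indexed from 0.
\<close>

definition fib :: "'a set \<Rightarrow> ('a \<Rightarrow> nat) \<Rightarrow> nat \<Rightarrow> 'a set" where
  "fib Y p w = {y \<in> Y. p y = w}"

definition Xi :: "nat \<Rightarrow> 'a::linorder set \<Rightarrow> ('a \<Rightarrow> nat) \<Rightarrow> ('a \<Rightarrow> nat) set" where
  "Xi e Y p = {\<psi> \<in> Y \<rightarrow>\<^sub>E {0..<e}. \<forall>y\<in>Y. \<forall>y'\<in>Y. y < y' \<and> p y = p y' \<longrightarrow> \<psi> y < \<psi> y'}"

definition eps :: "'a::linorder set \<Rightarrow> ('a \<Rightarrow> nat) \<Rightarrow> int" where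
  "eps Y \<psi> = (-1) ^ card {(y, y') \<in> Y \<times> Y. y < y' \<and> \<psi> y < \<psi> y'}"

text \<open>
  The symbol $\bar i^1 \otimes \cdots \otimes \bar i^r$ is the list of the lists $\bar i^\mu$.
\<close>

definition symbols :: "nat \<Rightarrow> 'a set \<Rightarrow> ('a \<Rightarrow> nat) \<Rightarrow> nat list \<Rightarrow> nat list list set" where
  "symbols e Y p ws = {\<xi>. length \<xi> = length ws \<and>
     (\<forall>\<mu><length ws. length (\<xi> ! \<mu>) = card (fib Y p (ws ! \<mu>)) \<and>
        sorted_wrt (<) (\<xi> ! \<mu>) \<and> set (\<xi> ! \<mu>) \<subseteq> {0..<e})}"

definition symbol_of :: "'a::linorder set \<Rightarrow> ('a \<Rightarrow> nat) \<Rightarrow> nat list \<Rightarrow> ('a \<Rightarrow> nat) \<Rightarrow> nat list list" where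
  "symbol_of Y p ws \<psi> = map (\<lambda>w. sorted_list_of_set (\<psi> ` fib Y p w)) ws"

text \<open>
  The identification of symbols with maps is the inverse of \<^const>\<open>symbol_of\<close>, which is a bijection
  by \<open>bij_betw_symbol_of\<close> below.
\<close>

definition map_of_symbol ::
  "nat \<Rightarrow> 'a::linorder set \<Rightarrow> ('a \<Rightarrow> nat) \<Rightarrow> nat list \<Rightarrow> nat list list \<Rightarrow> ('a \<Rightarrow> nat)" where
  "map_of_symbol e Y p ws = the_inv_into (Xi e Y p) (symbol_of Y p ws)"

definition zeta :: "nat \<Rightarrow> complex" where
  "zeta e = exp (2 * of_real pi * \<i> / of_nat e)"

definition cconst :: "nat \<Rightarrow> nat \<Rightarrow> nat \<Rightarrow> complex" where
  "cconst e m d = (-1) ^ (m * (e - 1)) * \<i> powi (- (int ((e - 1) choose 2) * int m))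
     * of_real (sqrt (real e)) powi (int d - int e * int m)"

definition S_matrix ::
  "nat \<Rightarrow> nat \<Rightarrow> 'a::linorder set \<Rightarrow> ('a \<Rightarrow> nat) \<Rightarrow> nat list \<Rightarrow> nat list list \<Rightarrow> nat list list \<Rightarrow> complex" where
  "S_matrix e m Y p ws i j = cnj (
     cnj (cconst e m (card Y))
     * of_int (eps Y (map_of_symbol e Y p ws i)) * of_int (eps Y (map_of_symbol e Y p ws j))
     * (\<Prod>\<mu><length ws. let n = card (fib Y p (ws ! \<mu>)) in
          \<Sum>\<sigma> | \<sigma> permutes {..<n}. of_int (sign \<sigma>) *
            (\<Prod>\<nu><n. 1 / of_real (sqrt (real e)) * zeta e ^ ((i ! \<mu> ! \<nu>) * (j ! \<mu> ! \<sigma> \<nu>)))))"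

definition symbols' ::
  "nat \<Rightarrow> nat \<Rightarrow> 'a set \<Rightarrow> ('a \<Rightarrow> nat) \<Rightarrow> nat list \<Rightarrow> nat list list set" where
  "symbols' e m Y p ws = {\<xi> \<in> symbols e Y p ws.
     [(\<Sum>\<mu><length ws. \<Sum>\<nu><card (fib Y p (ws ! \<mu>)). \<xi> ! \<mu> ! \<nu>) = m * (e choose 2)] (mod e)}"

text \<open>
  $(a_1,\dots,a_1+n_1-1) \otimes \cdots \otimes (a_r,\dots,a_r+n_r-1)$, with the entries of each tuple
  reduced modulo \<open>e\<close> and rearranged in increasing order.
\<close>

definition interval_symbol ::
  "nat \<Rightarrow> 'a set \<Rightarrow> ('a \<Rightarrow> nat) \<Rightarrow> nat list \<Rightarrow> (nat \<Rightarrow> int) \<Rightarrow> nat list list" where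
  "interval_symbol e Y p ws a =
     map (\<lambda>\<mu>. sort (map (\<lambda>k. nat ((a \<mu> + int k) mod int e)) [0..<card (fib Y p (ws ! \<mu>))]))
       [0..<length ws]"

definition struct_const ::
  "nat \<Rightarrow> nat \<Rightarrow> 'a::linorder set \<Rightarrow> ('a \<Rightarrow> nat) \<Rightarrow> nat list \<Rightarrow> nat list list
    \<Rightarrow> nat list list \<Rightarrow> nat list list \<Rightarrow> nat list list \<Rightarrow> complex" where
  "struct_const e m Y p ws \<xi>0 \<xi>1 \<xi>2 \<xi>3 =
     (\<Sum>\<xi> \<in> symbols' e m Y p ws.
        S_matrix e m Y p ws \<xi> \<xi>1 * S_matrix e m Y p ws \<xi> \<xi>2 * cnj (S_matrix e m Y p ws \<xi> \<xi>3)
          / S_matrix e m Y p ws \<xi> \<xi>0)"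

lemma map_sorted_list_of_set_fib:
  assumes "finite Y" "\<psi> \<in> Xi e Y p"
  shows "map \<psi> (sorted_list_of_set (fib Y p w)) = sorted_list_of_set (\<psi> ` fib Y p w)"
proof -
  have fin: "finite (fib Y p w)"
    using assms(1) by (simp add: fib_def)
  have "sorted_wrt (<) (map \<psi> (sorted_list_of_set (fib Y p w)))"
    unfolding sorted_wrt_map
    by (rule sorted_wrt_mono_rel[OF _ strict_sorted_list_of_set])
       (use assms(2) fin in \<open>auto simp: fib_def Xi_def\<close>)
  then show ?thesis
    using fin by (intro strict_sorted_equal) auto
qed

lemma bij_betw_symbol_of:
  assumes fin: "finite Y" and ws: "distinct ws" "set ws = p ` Y"
  shows "bij_betw (symbol_of Y p ws) (Xi e Y p) (symbols e Y p ws)"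
proof -
  have fin_fib: "finite (fib Y p w)" for w
    using fin by (simp add: fib_def)
  have "inj_on (symbol_of Y p ws) (Xi e Y p)"
  proof (rule inj_onI)
    fix \<psi> \<phi> assume psi: "\<psi> \<in> Xi e Y p" and phi: "\<phi> \<in> Xi e Y p"
      and eq: "symbol_of Y p ws \<psi> = symbol_of Y p ws \<phi>"
    have "\<psi> y = \<phi> y" if y: "y \<in> Y" for y
    proof -
      have "p y \<in> set ws" using y ws by auto
      then have "map \<psi> (sorted_list_of_set (fib Y p (p y))) = map \<phi> (sorted_list_of_set (fib Y p (p y)))"
        using eq map_sorted_list_of_set_fib[OF fin psi] map_sorted_list_of_set_fib[OF fin phi]
        by (auto simp: symbol_of_def)
      moreover have "y \<in> set (sorted_list_of_set (fib Y p (p y)))"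
        using y fin_fib by (simp add: fib_def)
      ultimately show ?thesis by (simp only: map_eq_conv)
    qed
    then show "\<psi> = \<phi>"
      using psi phi by (intro PiE_ext[of \<psi> Y "\<lambda>_. {0..<e}" \<phi>]) (auto simp: Xi_def)
  qed
  moreover have "symbol_of Y p ws \<psi> \<in> symbols e Y p ws" if psi: "\<psi> \<in> Xi e Y p" for \<psi>
  proof -
    have "length (sorted_list_of_set (\<psi> ` fib Y p w)) = card (fib Y p w)" for w
      using map_sorted_list_of_set_fib[OF fin psi, of w, symmetric] by simp
    moreover have "\<psi> ` fib Y p w \<subseteq> {0..<e}" for w
      using psi by (auto simp: Xi_def fib_def)
    ultimately show ?thesis
      using fin_fib by (auto simp: symbols_def symbol_of_def)
  qed
  moreover have "\<xi> \<in> symbol_of Y p ws ` Xi e Y p" if xi: "\<xi> \<in> symbols e Y p ws" for \<xi>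
  proof -
    define g where "g w = the (map_of (zip ws \<xi>) w)" for w
    define \<psi> where "\<psi> = (\<lambda>y\<in>Y. the (map_of (zip (sorted_list_of_set (fib Y p (p y))) (g (p y))) y))"
    have len: "length \<xi> = length ws" using xi by (simp add: symbols_def)
    have g: "g (ws ! \<mu>) = \<xi> ! \<mu>" if "\<mu> < length ws" for \<mu>
      using that len ws(1) by (simp add: g_def map_of_zip_nth)
    have gprops: "length (g w) = card (fib Y p w)" "sorted_wrt (<) (g w)" "set (g w) \<subseteq> {0..<e}"
      if "w \<in> set ws" for w
    proof -
      obtain \<mu> where "\<mu> < length ws" "w = ws ! \<mu>" using \<open>w \<in> set ws\<close> by (metis in_set_conv_nth)
      then show "length (g w) = card (fib Y p w)" "sorted_wrt (<) (g w)" "set (g w) \<subseteq> {0..<e}"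
        using g xi by (simp_all add: symbols_def)
    qed
    have psimap: "map \<psi> (sorted_list_of_set (fib Y p w)) = g w" if w: "w \<in> set ws" for w
    proof (rule nth_equalityI)
      show "length (map \<psi> (sorted_list_of_set (fib Y p w))) = length (g w)"
        using gprops(1)[OF w] by simp
    next
      fix k assume "k < length (map \<psi> (sorted_list_of_set (fib Y p w)))"
      then have k: "k < length (sorted_list_of_set (fib Y p w))" by simp
      then have "sorted_list_of_set (fib Y p w) ! k \<in> fib Y p w"
        using fin_fib by (metis nth_mem set_sorted_list_of_set)
      then have "\<psi> (sorted_list_of_set (fib Y p w) ! k) =
          the (map_of (zip (sorted_list_of_set (fib Y p w)) (g w)) (sorted_list_of_set (fib Y p w) ! k))"
        by (simp add: \<psi>_def fib_def)
      also have "\<dots> = g w ! k"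
        using k gprops(1)[OF w] by (subst map_of_zip_nth) auto
      finally show "map \<psi> (sorted_list_of_set (fib Y p w)) ! k = g w ! k" using k by simp
    qed
    have im: "\<psi> ` fib Y p w = set (g w)" if "w \<in> set ws" for w
      using arg_cong[OF psimap[OF that], of set] fin_fib by simp
    have "\<psi> \<in> Xi e Y p"
    proof -
      have "\<psi> y < e" if y: "y \<in> Y" for y
      proof -
        have "p y \<in> set ws" "y \<in> fib Y p (p y)" using y ws by (auto simp: fib_def)
        then show ?thesis using im gprops(3) by fastforce
      qed
      moreover have "\<psi> y < \<psi> y'" if y: "y \<in> Y" "y' \<in> Y" "y < y'" "p y = p y'" for y y'
      proof -
        let ?l = "sorted_list_of_set (fib Y p (p y))"
        have w: "p y \<in> set ws" using y ws by auto
        have "y \<in> set ?l" "y' \<in> set ?l" using y fin_fib by (auto simp: fib_def)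
        then obtain k k' where k: "k < length ?l" "?l ! k = y" "k' < length ?l" "?l ! k' = y'"
          by (metis in_set_conv_nth)
        have "k < k'"
        proof (rule ccontr)
          assume "\<not> k < k'"
          then have "?l ! k' \<le> ?l ! k"
            using k by (intro sorted_nth_mono) auto
          then show False using k y(3) by simp
        qed
        then have "map \<psi> ?l ! k < map \<psi> ?l ! k'"
          using gprops(2)[OF w] k psimap[OF w] by (metis length_map sorted_wrt_nth_less)
        then show ?thesis using k by simp
      qed
      ultimately show ?thesis by (auto simp: Xi_def \<psi>_def)
    qed
    moreover have "symbol_of Y p ws \<psi> = \<xi>"
    proof (rule nth_equalityI)
      show "length (symbol_of Y p ws \<psi>) = length \<xi>" using len by (simp add: symbol_of_def)
    next
      fix \<mu> assume "\<mu> < length (symbol_of Y p ws \<psi>)"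
      then have \<mu>: "\<mu> < length ws" by (simp add: symbol_of_def)
      then show "symbol_of Y p ws \<psi> ! \<mu> = \<xi> ! \<mu>"
        using map_sorted_list_of_set_fib[OF fin \<open>\<psi> \<in> Xi e Y p\<close>, of "ws ! \<mu>"] psimap[of "ws ! \<mu>"] g[OF \<mu>]
        by (simp add: symbol_of_def)
    qed
    ultimately show ?thesis by blast
  qed
  ultimately show ?thesis by (auto simp: bij_betw_def)
qed

end

theory Submission
  imports Defs "Jordan_Normal_Form.Determinant"
begin

text \<open>
  Since $|c|^2 = e$ and $e$ times the indicator of $E' \subseteq E$ is
  $\sum_{t<e} \zeta^{t(\sum i - m\binom e2)}$, the structure constant is, up to sign and
  conjugation, a sum over $t$ of $\pm\prod_\mu K_\mu(t)$, where
  $K(t) = e^{-n} \sum_i D(i,j_1+t)\, D(i,j_2)\, \overline{D(i,j_3)} / D(i,j_0)$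
  with $D(i,j) = \det(\zeta^{i_\nu j_k})$ and $i$ ranging over the increasing $n$-tuples; multiplication
  by $\zeta^{t \sum i}$ is a shift of $j_1$. As $j_0$ is an interval, $D(i,j_0)$ is up to sign a monomial
  times the Vandermonde determinant in $x_\nu = \zeta^{i_\nu}$, which divides $D(i,j_2)$ with a quotient
  that is an integer polynomial in $x$. Expanding $\overline{D(i,j_3)}$ turns the sum over increasing tuples
  of the remaining alternating function into a sum over all of $\{0,\dots,e-1\}^n$, and the average
  of an integer polynomial over $n$-tuples of $e$-th roots of unity is an integer.
\<close>

section \<open>Alternants: determinants in the powers of z\<close>

text \<open>These are the inner sums of \<open>S_matrix\<close> stripped of the factors 1/sqrt e.
  Index tuples are functions rather than lists, so that columns can be shifted, scaled and composed
  with permutations freely.\<close>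

definition alt :: "complex \<Rightarrow> nat \<Rightarrow> (nat \<Rightarrow> nat) \<Rightarrow> (nat \<Rightarrow> nat) \<Rightarrow> complex" where
  "alt z n i j = (\<Sum>\<sigma> | \<sigma> permutes {..<n}. of_int (sign \<sigma>) * (\<Prod>\<nu><n. z ^ (i \<nu> * j (\<sigma> \<nu>))))"

lemma permutes_lessThan:
  fixes n :: nat
  shows "\<sigma> permutes {..<n} \<Longrightarrow> k < n \<Longrightarrow> \<sigma> k < n"
  using permutes_in_image[of \<sigma> "{..<n}" k] by simp

lemma alt_eq_det: "alt z n i j = det (mat n n (\<lambda>(\<nu>, k). z ^ (i \<nu> * j k)))"
proof -
  have "(\<Prod>\<nu> = 0..<n. mat n n (\<lambda>(\<nu>, k). z ^ (i \<nu> * j k)) $$ (\<nu>, \<sigma> \<nu>)) = (\<Prod>\<nu><n. z ^ (i \<nu> * j (\<sigma> \<nu>)))"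
    if "\<sigma> permutes {..<n}" for \<sigma>
    unfolding atLeast0LessThan using that by (intro prod.cong) (auto simp: permutes_lessThan)
  then show ?thesis
    unfolding alt_def by (subst det_def'[of _ n]) (auto simp: atLeast0LessThan)
qed

lemma alt_cong:
  assumes "\<And>\<nu>. \<nu> < n \<Longrightarrow> i \<nu> = i' \<nu>" "\<And>\<nu>. \<nu> < n \<Longrightarrow> j \<nu> = j' \<nu>"
  shows "alt z n i j = alt z n i' j'"
  unfolding alt_eq_det using assms by (intro arg_cong[of _ _ det] cong_mat) auto

lemma alt_commute: "alt z n i j = alt z n j i"
proof -
  let ?A = "mat n n (\<lambda>(\<nu>, k). z ^ (i \<nu> * j k))"
  have "transpose_mat ?A = mat n n (\<lambda>(\<nu>, k). z ^ (j \<nu> * i k))"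
    by (intro eq_matI) (auto simp: mult.commute)
  then show ?thesis
    unfolding alt_eq_det using det_transpose[of ?A n] by simp
qed

lemma alt_permute_rows:
  assumes "\<tau> permutes {..<n}"
  shows "alt z n (i \<circ> \<tau>) j = of_int (sign \<tau>) * alt z n i j"
proof -
  let ?A = "mat n n (\<lambda>(\<nu>, k). z ^ (i \<nu> * j k))"
  have "mat n n (\<lambda>(\<nu>, k). z ^ ((i \<circ> \<tau>) \<nu> * j k)) = mat n n (\<lambda>(\<nu>, k). ?A $$ (\<tau> \<nu>, k))"
    using assms by (intro eq_matI) (auto simp: permutes_lessThan)
  then show ?thesis
    unfolding alt_eq_det using det_permute_rows[of ?A n \<tau>] assms by (simp add: atLeast0LessThan)
qed

lemma alt_permute_columns:
  assumes "\<tau> permutes {..<n}"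
  shows "alt z n i (j \<circ> \<tau>) = of_int (sign \<tau>) * alt z n i j"
  using alt_permute_rows[OF assms] by (metis alt_commute)

lemma alt_columns:
  "alt z n i j = (\<Sum>\<sigma> | \<sigma> permutes {..<n}. of_int (sign \<sigma>) * (\<Prod>\<nu><n. z ^ (i (\<sigma> \<nu>) * j \<nu>)))"
  unfolding alt_commute[of z n i] by (simp add: alt_def mult.commute)

text \<open>Swapping two equal entries fixes \<open>i\<close> but changes the sign of the
  alternant.\<close>

lemma alt_eq_0:
  assumes "\<not> inj_on i {..<n}"
  shows "alt z n i j = 0"
proof -
  obtain a b where ab: "a < n" "b < n" "a \<noteq> b" "i a = i b"
    using assms by (auto simp: inj_on_def)
  let ?\<tau> = "Transposition.transpose a b"
  have "?\<tau> permutes {..<n}"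
    using ab by (intro permutes_swap_id) auto
  moreover have "i \<circ> ?\<tau> = i"
    using ab by (auto simp: fun_eq_iff transpose_def)
  ultimately have "alt z n i j = - alt z n i j"
    using alt_permute_rows[of ?\<tau> n z i j] ab by (simp add: sign_swap_id)
  then show ?thesis
    by simp
qed

lemma alt_shift: "alt z n i (\<lambda>k. j k + t) = (\<Prod>\<nu><n. z ^ (i \<nu> * t)) * alt z n i j"
  unfolding alt_def by (simp add: sum_distrib_left algebra_simps power_add prod.distrib)

text \<open>The entries of the interval symbol are reduced modulo \<open>e\<close>; this allows
  replacing them by an unreduced interval of exponents.\<close>

lemma alt_exponent_cong:
  assumes "z ^ e = 1" "\<And>k. k < n \<Longrightarrow> [j k = j' k] (mod e)"
  shows "alt z n i j = alt z n i j'"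
proof -
  have mod: "z ^ k = z ^ (k mod e)" for k
    by (metis assms(1) mult_div_mod_eq power_add power_mult power_one mult_1)
  have "z ^ (i \<nu> * j k) = z ^ (i \<nu> * j' k)" if "k < n" for \<nu> k
    using assms(2)[OF that] mod[of "i \<nu> * j k"] mod[of "i \<nu> * j' k"]
    by (metis cong_def cong_scalar_left)
  then show ?thesis
    unfolding alt_eq_det by (intro arg_cong[of _ _ det] cong_mat) auto
qed

section \<open>Roots of unity\<close>

lemma cnj_root_of_unity:
  assumes "z ^ e = 1" "e \<ge> 1"
  shows "cnj z = z ^ (e - 1)"
proof -
  have "norm z ^ e = 1"
    using assms(1) by (metis norm_one norm_power)
  then have "norm z = 1"
    using assms(2) by (auto dest: power_eq_1_iff)
  then have "z * cnj z = 1"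
    by (simp add: complex_norm_square[symmetric])
  moreover have "z * z ^ (e - 1) = 1"
    using assms by (cases e) auto
  moreover have "z \<noteq> 0"
    using \<open>norm z = 1\<close> by auto
  ultimately show ?thesis
    by (metis mult_cancel_left)
qed

text \<open>Conjugation negates exponents, and \<open>e - 1\<close> is a natural number representing
  -1 modulo \<open>e\<close>. The conjugate is thus again an alternant with exponents in
  \<open>nat\<close>.\<close>

lemma cnj_alt:
  assumes "z ^ e = 1" "e \<ge> 1"
  shows "cnj (alt z n i j) = alt z n i (\<lambda>k. (e - 1) * j k)"
  unfolding alt_def
  by (simp add: cnj_root_of_unity[OF assms] power_mult[symmetric] mult_ac)

lemma sum_powers_root_of_unity:
  fixes z :: complex
  assumes "z ^ e = 1"
  shows "(\<Sum>t<e. z ^ (t * k)) = (if z ^ k = 1 then of_nat e else 0)"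
proof (cases "z ^ k = 1")
  case True
  then show ?thesis
    by (simp add: mult.commute[of _ k] power_mult)
next
  case False
  have "(\<Sum>t<e. z ^ (t * k)) = (\<Sum>t<e. (z ^ k) ^ t)"
    by (simp add: power_mult[symmetric] mult.commute)
  also have "\<dots> = ((z ^ k) ^ e - 1) / (z ^ k - 1)"
    using False by (rule geometric_sum)
  also have "(z ^ k) ^ e = 1"
    using assms by (metis power_mult mult.commute power_one)
  finally show ?thesis
    using False by simp
qed

section \<open>Integer polynomials and their averages over roots of unity\<close>

text \<open>The functions given by polynomials with integer coefficients in n variables.
  Multiplication by a single variable replaces products as a constructor, so that an induction on
  averages only has to raise one exponent.\<close>

inductive intpoly :: "nat \<Rightarrow> ((nat \<Rightarrow> complex) \<Rightarrow> complex) \<Rightarrow> bool" for n where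
  const: "intpoly n (\<lambda>x. of_int c)"
| add: "intpoly n f \<Longrightarrow> intpoly n g \<Longrightarrow> intpoly n (\<lambda>x. f x + g x)"
| var_mult: "\<nu> < n \<Longrightarrow> intpoly n f \<Longrightarrow> intpoly n (\<lambda>x. x \<nu> * f x)"

lemma intpoly_0: "intpoly n (\<lambda>x. 0)" and intpoly_1: "intpoly n (\<lambda>x. 1)"
  using intpoly.const[of n 0] intpoly.const[of n 1] by simp_all

text \<open>Induction on the first factor moves its variables outside; a remaining constant is
  absorbed by a second induction on the other factor.\<close>

lemma intpoly_mult:
  assumes "intpoly n f" "intpoly n g"
  shows "intpoly n (\<lambda>x. f x * g x)"
  using assms(1)
proof induction
  case (const c)
  from assms(2) show ?case
  proof induction
    case (const b)
    then show ?case
      using intpoly.const[of n "c * b"] by simp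
  next
    case (add f g)
    then show ?case
      using intpoly.add[OF add.IH] by (simp add: algebra_simps)
  next
    case (var_mult \<nu> f)
    then show ?case
      using intpoly.var_mult[OF var_mult.hyps(1) var_mult.IH] by (simp add: algebra_simps)
  qed
next
  case (add f f')
  then show ?case
    using intpoly.add[OF add.IH] by (simp add: algebra_simps)
next
  case (var_mult \<nu> f)
  then show ?case
    using intpoly.var_mult[OF var_mult.hyps(1) var_mult.IH] by (simp add: algebra_simps)
qed

lemma intpoly_diff:
  assumes "intpoly n f" "intpoly n g"
  shows "intpoly n (\<lambda>x. f x - g x)"
  using intpoly.add[OF assms(1) intpoly_mult[OF intpoly.const[of n "-1"] assms(2)]] by simp

lemma intpoly_sum:
  assumes "\<And>a. a \<in> A \<Longrightarrow> intpoly n (f a)"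
  shows "intpoly n (\<lambda>x. \<Sum>a\<in>A. f a x)"
  using assms by (induction A rule: infinite_finite_induct) (auto intro: intpoly_0 intpoly.add)

lemma intpoly_prod:
  assumes "\<And>a. a \<in> A \<Longrightarrow> intpoly n (f a)"
  shows "intpoly n (\<lambda>x. \<Prod>a\<in>A. f a x)"
  using assms by (induction A rule: infinite_finite_induct) (auto intro: intpoly_1 intpoly_mult)

text \<open>The average of a monomial over tuples of powers of \<open>z\<close> is a product of
  averages, each 0 or 1. The exponents \<open>k\<close> are arbitrary so that the induction can
  absorb a variable of the polynomial into the monomial.\<close>

lemma intpoly_average_in_Ints:
  assumes "intpoly n f" "z ^ e = 1"
  shows "(\<Sum>i \<in> {..<n} \<rightarrow>\<^sub>E {..<e}. f (\<lambda>\<nu>. z ^ i \<nu>) * (\<Prod>\<nu><n. z ^ (i \<nu> * k \<nu>))) / of_nat e ^ n \<in> \<int>"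
  using assms(1)
proof (induction arbitrary: k)
  case (const c)
  have "(\<Sum>i \<in> {..<n} \<rightarrow>\<^sub>E {..<e}. of_int c * (\<Prod>\<nu><n. z ^ (i \<nu> * k \<nu>))) / of_nat e ^ n
      = of_int c * (\<Prod>\<nu><n. (\<Sum>t<e. z ^ (t * k \<nu>)) / of_nat e)"
    by (simp add: sum_distrib_left[symmetric] prod_sum_PiE prod_dividef)
  also have "\<dots> \<in> \<int>"
    unfolding sum_powers_root_of_unity[OF assms(2)] by (intro Ints_mult Ints_prod) auto
  finally show ?case .
next
  case (add f g)
  then show ?case
    by (simp add: distrib_right sum.distrib add_divide_distrib)
next
  case (var_mult \<mu> f)
  have "(\<Prod>\<nu><n. z ^ (i \<nu> * (k(\<mu> := Suc (k \<mu>))) \<nu>)) = z ^ i \<mu> * (\<Prod>\<nu><n. z ^ (i \<nu> * k \<nu>))" for i :: "nat \<Rightarrow> nat"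
    using var_mult.hyps(1)
    by (subst (1 2) prod.remove[of "{..<n}" \<mu>]) (auto simp: power_add)
  then show ?case
    using var_mult.IH[of "k(\<mu> := Suc (k \<mu>))"] by (simp add: mult_ac)
qed

section \<open>Divisibility of alternants by the Vandermonde determinant\<close>

text \<open>The coefficients are signed elementary symmetric functions of the first \<open>k\<close>
  variables; only their integrality and the leading coefficient 1 are recorded.\<close>

lemma intpoly_coeffs_prod_linear:
  assumes "k \<le> n"
  shows "\<exists>b. (\<forall>l. intpoly n (b l)) \<and> (\<forall>x. b k x = 1) \<and>
           (\<forall>x X. (\<Prod>m<k. X - x m) = (\<Sum>l\<le>k. b l x * X ^ l))"
  using assms
proof (induction k)
  case 0
  show ?case
    by (intro exI[of _ "\<lambda>_ _. 1"]) (auto intro: intpoly_1)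
next
  case (Suc k)
  then obtain b where b: "\<And>l. intpoly n (b l)" "\<And>x. b k x = 1"
    "\<And>x X. (\<Prod>m<k. X - x m) = (\<Sum>l\<le>k. b l x * X ^ l)" by auto
  \<comment> \<open>Multiplying by \<open>X - x k\<close> shifts the coefficients by one and
    subtracts \<open>x k\<close> times the old ones. The second guard discards \<open>b l\<close>
    for \<open>l > k\<close>, whose values the expansion does not fix.\<close>
  define b' where "b' l = (\<lambda>x. (if l = 0 then 0 else b (l - 1) x) - (if l \<le> k then x k * b l x else 0))" for l
  have "intpoly n (\<lambda>x. if l = 0 then 0 else b (l - 1) x)" for l
    by (cases "l = 0") (auto intro: intpoly_0 b)
  moreover have "intpoly n (\<lambda>x. if l \<le> k then x k * b l x else 0)" for l
    using Suc.prems by (cases "l \<le> k") (auto intro: intpoly_0 intpoly.var_mult b)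
  ultimately have "intpoly n (b' l)" for l
    unfolding b'_def by (rule intpoly_diff)
  moreover have "b' (Suc k) x = 1" for x
    by (simp add: b'_def b)
  moreover have "(\<Prod>m<Suc k. X - x m) = (\<Sum>l\<le>Suc k. b' l x * X ^ l)" for x X
  proof -
    have "(\<Sum>l\<le>Suc k. b' l x * X ^ l) =
      (\<Sum>l\<le>Suc k. (if l = 0 then 0 else b (l - 1) x) * X ^ l) - (\<Sum>l\<le>Suc k. (if l \<le> k then x k * b l x else 0) * X ^ l)"
      by (simp add: b'_def algebra_simps sum_subtractf)
    also have "(\<Sum>l\<le>Suc k. (if l = 0 then 0 else b (l - 1) x) * X ^ l) = X * (\<Sum>l\<le>k. b l x * X ^ l)"
      by (subst sum.atMost_Suc_shift) (simp add: sum_distrib_left mult_ac)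
    also have "(\<Sum>l\<le>Suc k. (if l \<le> k then x k * b l x else 0) * X ^ l) = x k * (\<Sum>l\<le>k. b l x * X ^ l)"
      by (simp add: sum_distrib_left mult_ac)
    finally show ?thesis
      by (simp add: b(3) algebra_simps)
  qed
  ultimately show ?case by blast
qed

text \<open>
  Each $x_\nu$ is a root of the monic polynomial $\prod_\mu (X - x_\mu)$, modulo which $X^j$ can be
  reduced to degree less than $n$.
\<close>

lemma power_reduction:
  "\<exists>c. (\<forall>l. intpoly n (c l)) \<and> (\<forall>x. \<forall>\<nu><n. x \<nu> ^ j = (\<Sum>l<n. c l x * x \<nu> ^ l))"
proof (cases n)
  case 0
  then show ?thesis
    by (intro exI[of _ "\<lambda>_ _. 0"]) (auto intro: intpoly_0)
next
  case (Suc n')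
  obtain b where b: "\<And>l. intpoly n (b l)" "\<And>x. b n x = 1"
    "\<And>x X. (\<Prod>m<n. X - x m) = (\<Sum>l\<le>n. b l x * X ^ l)"
    using intpoly_coeffs_prod_linear[of n n] by auto
  have xn: "x \<nu> ^ n = - (\<Sum>l<n. b l x * x \<nu> ^ l)" if "\<nu> < n" for x \<nu>
  proof -
    have "(\<Prod>m<n. x \<nu> - x m) = 0"
      using that by auto
    then show ?thesis
      unfolding b(3) using b(2) by (simp add: lessThan_Suc_atMost[symmetric] eq_neg_iff_add_eq_0 add.commute)
  qed
  show ?thesis
  proof (induction j)
    case 0
    have "intpoly n (\<lambda>x. if l = 0 then 1 else 0)" for l :: nat
      by (auto intro: intpoly_0 intpoly_1)
    moreover have "(\<Sum>l<n. (if l = 0 then 1 else 0) * X ^ l) = 1" for X :: complex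
      unfolding Suc sum.lessThan_Suc_shift by simp
    ultimately show ?case
      by (intro exI[of _ "\<lambda>l x. if l = 0 then 1 else 0"]) auto
  next
    case (Suc j)
    then obtain c where c: "\<And>l. intpoly n (c l)" "\<And>x \<nu>. \<nu> < n \<Longrightarrow> x \<nu> ^ j = (\<Sum>l<n. c l x * x \<nu> ^ l)"
      by blast
    \<comment> \<open>Multiplying the reduction of the j-th power by the variable shifts its
      coefficients; the top term with coefficient \<open>c n'\<close> then has degree n and is
      reduced by \<open>xn\<close>.\<close>
    have "intpoly n (\<lambda>x. (if l = 0 then 0 else c (l - 1) x) - c n' x * b l x)" for l
    proof (rule intpoly_diff)
      show "intpoly n (\<lambda>x. if l = 0 then 0 else c (l - 1) x)"
        by (cases "l = 0") (auto intro: intpoly_0 c)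
      show "intpoly n (\<lambda>x. c n' x * b l x)"
        by (intro intpoly_mult b c)
    qed
    moreover have "x \<nu> ^ Suc j = (\<Sum>l<n. ((if l = 0 then 0 else c (l - 1) x) - c n' x * b l x) * x \<nu> ^ l)"
      if "\<nu> < n" for x \<nu>
    proof -
      have "x \<nu> ^ Suc j = (\<Sum>l<n. c l x * x \<nu> ^ Suc l)"
        using c(2)[OF that] by (simp add: sum_distrib_left mult_ac)
      also have "\<dots> = (\<Sum>l<n'. c l x * x \<nu> ^ Suc l) + c n' x * x \<nu> ^ n"
        using \<open>n = Suc n'\<close> by simp
      also have "(\<Sum>l<n'. c l x * x \<nu> ^ Suc l) = (\<Sum>l<n. (if l = 0 then 0 else c (l - 1) x) * x \<nu> ^ l)"
        unfolding \<open>n = Suc n'\<close> sum.lessThan_Suc_shift by simp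
      finally show ?thesis
        unfolding xn[OF that] by (simp add: algebra_simps sum_subtractf sum_distrib_left)
    qed
    ultimately show ?case
      by (intro exI[of _ "\<lambda>l x. (if l = 0 then 0 else c (l - 1) x) - c n' x * b l x"]) auto
  qed
qed

text \<open>
  The factor \<open>C\<close> is 0 or, up to sign, a Schur function; only the integrality of its coefficients matters.
\<close>

lemma alt_eq_vandermonde_mult:
  "\<exists>C. intpoly n C \<and> (\<forall>i. alt z n i j = alt z n i (\<lambda>k. k) * C (\<lambda>\<nu>. z ^ i \<nu>))"
proof -
  obtain c where c: "\<And>k l. intpoly n (c k l)" "\<And>k x \<nu>. \<nu> < n \<Longrightarrow> x \<nu> ^ k = (\<Sum>l<n. c k l x * x \<nu> ^ l)"
    using power_reduction[of n] by metis
  \<comment> \<open>Column \<open>k\<close> holds the coordinates of the power with exponent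
    \<open>j k\<close> in the basis 1, X, ..., X^(n-1), so that the matrix of
    \<open>alt z n i j\<close> is the Vandermonde matrix times \<open>M\<close>. No division occurs,
    hence the identity also holds where the Vandermonde determinant vanishes.\<close>
  define M where "M x = mat n n (\<lambda>(l, k). c (j k) l x)" for x
  have "(\<lambda>x. det (M x)) = (\<lambda>x. \<Sum>\<sigma> | \<sigma> permutes {..<n}. of_int (sign \<sigma>) * (\<Prod>l<n. c (j (\<sigma> l)) l x))"
  proof
    fix x
    have "(\<Prod>l = 0..<n. M x $$ (l, \<sigma> l)) = (\<Prod>l<n. c (j (\<sigma> l)) l x)" if "\<sigma> permutes {..<n}" for \<sigma>
      unfolding atLeast0LessThan M_def using that by (intro prod.cong) (auto simp: permutes_lessThan)
    then show "det (M x) = (\<Sum>\<sigma> | \<sigma> permutes {..<n}. of_int (sign \<sigma>) * (\<Prod>l<n. c (j (\<sigma> l)) l x))"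
      by (subst det_def'[of _ n]) (auto simp: atLeast0LessThan M_def)
  qed
  moreover have "intpoly n (\<lambda>x. \<Sum>\<sigma> | \<sigma> permutes {..<n}. of_int (sign \<sigma>) * (\<Prod>l<n. c (j (\<sigma> l)) l x))"
    by (intro intpoly_sum intpoly_mult intpoly_prod intpoly.const c)
  ultimately have "intpoly n (\<lambda>x. det (M x))" by simp
  moreover have "alt z n i j = alt z n i (\<lambda>k. k) * det (M (\<lambda>\<nu>. z ^ i \<nu>))" for i
  proof -
    let ?x = "\<lambda>\<nu>. z ^ i \<nu>"
    let ?V = "mat n n (\<lambda>(\<nu>, k). z ^ (i \<nu> * k))"
    have "mat n n (\<lambda>(\<nu>, k). z ^ (i \<nu> * j k)) = ?V * M ?x"
    proof (rule eq_matI)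
      fix \<nu> k assume "\<nu> < dim_row (?V * M ?x)" "k < dim_col (?V * M ?x)"
      then have "\<nu> < n" "k < n" by (auto simp: M_def)
      then show "mat n n (\<lambda>(\<nu>, k). z ^ (i \<nu> * j k)) $$ (\<nu>, k) = (?V * M ?x) $$ (\<nu>, k)"
        using c(2)[of \<nu> ?x "j k"]
        by (simp add: M_def scalar_prod_def atLeast0LessThan power_mult mult.commute[of _ "c _ _ _"])
    qed (auto simp: M_def)
    then show ?thesis
      unfolding alt_eq_det using det_mult[of ?V n "M ?x"] by (simp add: M_def)
  qed
  ultimately show ?thesis by blast
qed

section \<open>Increasing tuples versus arbitrary tuples\<close>

definition sorted_tuples :: "nat \<Rightarrow> nat \<Rightarrow> nat list set" where
  "sorted_tuples n e = {l. length l = n \<and> sorted_wrt (<) l \<and> set l \<subseteq> {0..<e}}"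

lemma finite_sorted_tuples: "finite (sorted_tuples n e)"
  unfolding sorted_tuples_def
  by (rule finite_subset[OF _ finite_lists_length_eq[of "{0..<e}" n]]) auto

text \<open>An injective tuple is the increasing list of its values, read in a uniquely determined
  order.\<close>

lemma bij_betw_sorted_tuples_permutes:
  "bij_betw (\<lambda>(l, \<sigma>). \<lambda>\<nu>\<in>{..<n}. l ! \<sigma> \<nu>) (sorted_tuples n e \<times> {\<sigma>. \<sigma> permutes {..<n}})
     {i \<in> {..<n} \<rightarrow>\<^sub>E {..<e}. inj_on i {..<n}}"
proof -
  let ?\<phi> = "\<lambda>l \<sigma>. \<lambda>\<nu>\<in>{..<n}. l ! \<sigma> \<nu>"
  have dist: "distinct l" "length l = n" "set l \<subseteq> {..<e}" "sorted_wrt (<) l" if "l \<in> sorted_tuples n e" for l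
    using that by (auto simp: sorted_tuples_def strict_sorted_iff)
  have img: "?\<phi> l \<sigma> ` {..<n} = set l" if "l \<in> sorted_tuples n e" "\<sigma> permutes {..<n}" for l \<sigma>
  proof -
    have "?\<phi> l \<sigma> ` {..<n} = nth l ` (\<sigma> ` {..<n})"
      by (auto simp: image_image)
    also have "\<dots> = set l"
      using permutes_image[OF that(2)] dist[OF that(1)] by (auto simp: set_conv_nth)
    finally show ?thesis .
  qed
  have inj: "l = l' \<and> \<sigma> = \<sigma>'"
    if l: "l \<in> sorted_tuples n e" "l' \<in> sorted_tuples n e"
      and \<sigma>: "\<sigma> permutes {..<n}" "\<sigma>' permutes {..<n}" and eq: "?\<phi> l \<sigma> = ?\<phi> l' \<sigma>'" for l l' \<sigma> \<sigma>'
  proof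
    have "set l = set l'"
      using img[OF l(1) \<sigma>(1)] img[OF l(2) \<sigma>(2)] eq by simp
    then show "l = l'"
      using dist(4)[OF l(1)] dist(4)[OF l(2)] by (intro strict_sorted_equal) auto
    show "\<sigma> = \<sigma>'"
    proof
      fix \<nu>
      show "\<sigma> \<nu> = \<sigma>' \<nu>"
      proof (cases "\<nu> < n")
        case True
        then have "l ! \<sigma> \<nu> = l ! \<sigma>' \<nu>"
          using fun_cong[OF eq, of \<nu>] \<open>l = l'\<close> by simp
        then show ?thesis
          using True dist[OF l(1)] permutes_lessThan[OF \<sigma>(1)] permutes_lessThan[OF \<sigma>(2)]
          by (simp add: nth_eq_iff_index_eq)
      next
        case False
        then show ?thesis
          using \<sigma> by (simp add: permutes_def)
      qed
    qed
  qed
  have into: "?\<phi> l \<sigma> \<in> {..<n} \<rightarrow>\<^sub>E {..<e}" "inj_on (?\<phi> l \<sigma>) {..<n}"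
    if l: "l \<in> sorted_tuples n e" and \<sigma>: "\<sigma> permutes {..<n}" for l \<sigma>
  proof -
    show "?\<phi> l \<sigma> \<in> {..<n} \<rightarrow>\<^sub>E {..<e}"
    proof (rule PiE_I)
      fix \<nu> assume "\<nu> \<in> {..<n}"
      then have "?\<phi> l \<sigma> \<nu> \<in> set l"
        using img[OF l \<sigma>] by blast
      then show "?\<phi> l \<sigma> \<nu> \<in> {..<e}"
        using dist(3)[OF l] by blast
    qed simp
    show "inj_on (?\<phi> l \<sigma>) {..<n}"
      using img[OF l \<sigma>] dist(1,2)[OF l]
      by (intro eq_card_imp_inj_on) (auto simp: distinct_card)
  qed
  have onto: "\<exists>l\<in>sorted_tuples n e. \<exists>\<sigma>. \<sigma> permutes {..<n} \<and> i = ?\<phi> l \<sigma>"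
    if i: "i \<in> {..<n} \<rightarrow>\<^sub>E {..<e}" "inj_on i {..<n}" for i
  proof (intro bexI exI conjI)
    let ?l = "sorted_list_of_set (i ` {..<n})"
    have len: "length ?l = n"
      using i(2) by (simp add: card_image)
    have l: "bij_betw (nth ?l) {..<n} (i ` {..<n})"
      using bij_betw_nth[of ?l "{..<n}"] len by simp
    show "?l \<in> sorted_tuples n e"
      using len PiE_mem[OF i(1)] by (auto simp: sorted_tuples_def)
    \<comment> \<open>The rank of each value of \<open>i\<close> among all its values; to become a
      permutation in the sense of \<open>permutes\<close> it is extended by the identity
      below.\<close>
    define g where "g = inv_into {..<n} (nth ?l) \<circ> i"
    have g: "bij_betw g {..<n} {..<n}"
      unfolding g_def by (rule bij_betw_trans[OF bij_betw_imageI[OF i(2) refl] bij_betw_inv_into[OF l]])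
    let ?\<sigma> = "\<lambda>\<nu>. if \<nu> < n then g \<nu> else \<nu>"
    show "?\<sigma> permutes {..<n}"
    proof (rule bij_imp_permutes)
      have "bij_betw ?\<sigma> {..<n} {..<n} = bij_betw g {..<n} {..<n}"
        by (rule bij_betw_cong) simp
      then show "bij_betw ?\<sigma> {..<n} {..<n}"
        using g by blast
    qed simp
    have "?l ! g \<nu> = i \<nu>" if "\<nu> < n" for \<nu>
      unfolding g_def using that bij_betw_inv_into_right[OF l, of "i \<nu>"] by simp
    then show "i = ?\<phi> ?l ?\<sigma>"
      using i(1) by (intro ext) (simp add: PiE_arb[OF i(1)])
  qed
  show ?thesis
  proof (rule bij_betw_imageI)
    show "inj_on (\<lambda>(l, \<sigma>). ?\<phi> l \<sigma>) (sorted_tuples n e \<times> {\<sigma>. \<sigma> permutes {..<n}})"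
    proof (rule inj_onI)
      fix x y
      assume x: "x \<in> sorted_tuples n e \<times> {\<sigma>. \<sigma> permutes {..<n}}" and y: "y \<in> sorted_tuples n e \<times> {\<sigma>. \<sigma> permutes {..<n}}"
        and eq: "(case x of (l, \<sigma>) \<Rightarrow> ?\<phi> l \<sigma>) = (case y of (l, \<sigma>) \<Rightarrow> ?\<phi> l \<sigma>)"
      obtain l \<sigma> l' \<sigma>' where xy: "x = (l, \<sigma>)" "y = (l', \<sigma>')"
        by (metis prod.exhaust)
      have "l = l' \<and> \<sigma> = \<sigma>'"
        using x y eq unfolding xy by (intro inj) simp_all
      then show "x = y"
        unfolding xy by simp
    qed
    show "(\<lambda>(l, \<sigma>). ?\<phi> l \<sigma>) ` (sorted_tuples n e \<times> {\<sigma>. \<sigma> permutes {..<n}})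
        = {i \<in> {..<n} \<rightarrow>\<^sub>E {..<e}. inj_on i {..<n}}" (is "?f ` ?S = ?T")
    proof
      show "?f ` ?S \<subseteq> ?T"
      proof (rule image_subsetI)
        fix x assume x: "x \<in> ?S"
        obtain l \<sigma> where "x = (l, \<sigma>)"
          by (rule prod.exhaust)
        then show "?f x \<in> ?T"
          using x into[of l \<sigma>] by simp
      qed
      show "?T \<subseteq> ?f ` ?S"
      proof
        fix i assume "i \<in> ?T"
        then obtain l \<sigma> where "l \<in> sorted_tuples n e" "\<sigma> permutes {..<n}" "i = ?\<phi> l \<sigma>"
          using onto[of i] by blast
        then show "i \<in> ?f ` ?S"
          by (intro image_eqI[of _ _ "(l, \<sigma>)"]) simp_all
      qed
    qed
  qed
qed

text \<open>The alternant is expanded over permutations of the row indices. The sign of each term is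
  absorbed by \<open>A\<close>, so that list and permutation together run over the injective tuples.
  The other tuples may be added because \<open>A\<close> vanishes on them.\<close>

lemma sum_sorted_tuples_alternating:
  assumes cong: "\<And>i i'. (\<And>\<nu>. \<nu> < n \<Longrightarrow> i \<nu> = i' \<nu>) \<Longrightarrow> A i = A i'"
    and permute: "\<And>i \<tau>. \<tau> permutes {..<n} \<Longrightarrow> A (i \<circ> \<tau>) = of_int (sign \<tau>) * A i"
    and zero: "\<And>i. \<not> inj_on i {..<n} \<Longrightarrow> A i = 0"
  shows "(\<Sum>l\<in>sorted_tuples n e. A (nth l) * alt z n (nth l) j)
       = (\<Sum>i \<in> {..<n} \<rightarrow>\<^sub>E {..<e}. A i * (\<Prod>\<nu><n. z ^ (i \<nu> * j \<nu>)))"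
proof -
  let ?P = "{\<sigma>. \<sigma> permutes {..<n}}"
  let ?G = "\<lambda>i. A i * (\<Prod>\<nu><n. z ^ (i \<nu> * j \<nu>))"
  let ?\<phi> = "\<lambda>l \<sigma>. \<lambda>\<nu>\<in>{..<n}. l ! \<sigma> \<nu>"
  have "A (nth l) * (of_int (sign \<sigma>) * (\<Prod>\<nu><n. z ^ (l ! \<sigma> \<nu> * j \<nu>))) = ?G (?\<phi> l \<sigma>)"
    if "\<sigma> \<in> ?P" for l \<sigma>
    using that permute[of \<sigma> "nth l"] cong[of "nth l \<circ> \<sigma>" "?\<phi> l \<sigma>"] by simp
  then have "(\<Sum>l\<in>sorted_tuples n e. A (nth l) * alt z n (nth l) j)
      = (\<Sum>l\<in>sorted_tuples n e. \<Sum>\<sigma>\<in>?P. ?G (?\<phi> l \<sigma>))"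
    unfolding alt_columns sum_distrib_left by (intro sum.cong refl)
  also have "\<dots> = (\<Sum>(l, \<sigma>) \<in> sorted_tuples n e \<times> ?P. ?G (?\<phi> l \<sigma>))"
    by (rule sum.cartesian_product)
  also have "\<dots> = (\<Sum>i \<in> {i \<in> {..<n} \<rightarrow>\<^sub>E {..<e}. inj_on i {..<n}}. ?G i)"
    using sum.reindex_bij_betw[OF bij_betw_sorted_tuples_permutes[of n e], of ?G]
    by (simp add: case_prod_unfold)
  also have "\<dots> = (\<Sum>i \<in> {..<n} \<rightarrow>\<^sub>E {..<e}. ?G i)"
    using zero by (intro sum.mono_neutral_left) (auto intro: finite_PiE)
  finally show ?thesis .
qed

section \<open>Integrality of the contribution of a single fibre\<close>

lemma intpoly_alt: "\<exists>P. intpoly n P \<and> (\<forall>i. alt z n i j = P (\<lambda>\<nu>. z ^ i \<nu>))"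
proof (intro exI conjI allI)
  have "intpoly n (\<lambda>x. x \<nu> ^ k)" if "\<nu> < n" for \<nu> k
    by (induction k) (auto intro: intpoly_1 intpoly.var_mult that)
  then show "intpoly n (\<lambda>x. \<Sum>\<sigma> | \<sigma> permutes {..<n}. of_int (sign \<sigma>) * (\<Prod>\<nu><n. x \<nu> ^ j (\<sigma> \<nu>)))"
    by (intro intpoly_sum intpoly_mult intpoly_prod intpoly.const) simp
qed (simp add: alt_def power_mult)

text \<open>The hypothesis on \<open>j0\<close> says that, modulo \<open>e\<close> and up to order,
  it is an interval of n consecutive exponents starting at \<open>b\<close>; its alternant is then a
  sign times a monomial times the Vandermonde determinant.\<close>

lemma sum_alt_quotient_in_Ints:
  assumes z: "z ^ e = 1" and e: "e \<ge> 1"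
    and \<tau>: "\<tau> permutes {..<n}" and j0: "\<And>k. k < n \<Longrightarrow> [j0 k = \<tau> k + b] (mod e)"
  shows "(\<Sum>l\<in>sorted_tuples n e. alt z n (nth l) j1 * alt z n (nth l) j2
            * cnj (alt z n (nth l) j3) / alt z n (nth l) j0) / of_nat e ^ n \<in> \<int>"
proof -
  \<comment> \<open>\<open>C1\<close> is for the case of a vanishing Vandermonde determinant, where
    the alternant of \<open>j1\<close> must vanish as well. Otherwise the division takes place in
    the alternant of \<open>j2\<close>, through \<open>C2\<close>.\<close>
  obtain C1 where C1: "\<And>i. alt z n i j1 = alt z n i (\<lambda>k. k) * C1 (\<lambda>\<nu>. z ^ i \<nu>)"
    using alt_eq_vandermonde_mult by blast
  obtain C2 where C2: "intpoly n C2" "\<And>i. alt z n i j2 = alt z n i (\<lambda>k. k) * C2 (\<lambda>\<nu>. z ^ i \<nu>)"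
    using alt_eq_vandermonde_mult by blast
  \<comment> \<open>Dividing by the monomial of exponent \<open>b\<close> amounts to shifting
    \<open>j1\<close> by -b, represented by \<open>(e - 1) * b\<close>. The shifted alternant is
    itself an integer polynomial.\<close>
  obtain P where P: "intpoly n P" "\<And>i. alt z n i (\<lambda>k. j1 k + (e - 1) * b) = P (\<lambda>\<nu>. z ^ i \<nu>)"
    using intpoly_alt by blast
  let ?m = "\<lambda>i t. \<Prod>\<nu><n. z ^ (i \<nu> * t)"
  define s :: complex where "s = of_int (sign \<tau>)"
  define A where "A i = alt z n i j1 * alt z n i j2 / alt z n i j0" for i
  have s: "s * s = 1" "s \<noteq> 0"
    by (simp_all add: s_def sign_def)
  have m: "?m i ((e - 1) * b) * ?m i b = 1" for i
  proof -
    have "z ^ (i \<nu> * ((e - 1) * b)) * z ^ (i \<nu> * b) = 1" for \<nu>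
    proof -
      have "i \<nu> * ((e - 1) * b) + i \<nu> * b = e * (i \<nu> * b)"
        using e by (cases e) (simp_all add: algebra_simps)
      then show ?thesis
        by (metis power_add power_mult power_one z)
    qed
    then show ?thesis
      by (simp only: prod.distrib[symmetric] prod.neutral_const)
  qed
  have alt_j0: "alt z n i j0 = s * ?m i b * alt z n i (\<lambda>k. k)" for i
  proof -
    have "alt z n i j0 = alt z n i (\<lambda>k. \<tau> k + b)"
      using z j0 by (rule alt_exponent_cong)
    also have "\<dots> = ?m i b * alt z n i ((\<lambda>k. k) \<circ> \<tau>)"
      by (simp add: alt_shift o_def)
    finally show ?thesis
      by (simp add: alt_permute_columns[OF \<tau>] s_def)
  qed
  \<comment> \<open>If the Vandermonde determinant vanishes, both sides are 0 (on the left because $x/0 = 0$).\<close>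
  have A_eq: "A i = s * (P (\<lambda>\<nu>. z ^ i \<nu>) * C2 (\<lambda>\<nu>. z ^ i \<nu>))" for i
  proof (cases "alt z n i (\<lambda>k. k) = 0")
    case True
    then show ?thesis
      using C1[of i] P(2)[of i] by (simp add: A_def alt_shift)
  next
    case False
    have "?m i b \<noteq> 0"
      using m[of i] by (metis mult_zero_right zero_neq_one)
    then have "A i = alt z n i j1 * C2 (\<lambda>\<nu>. z ^ i \<nu>) / (s * ?m i b)"
      unfolding A_def alt_j0 C2(2) using False by simp
    also have "\<dots> = s * ?m i ((e - 1) * b) * alt z n i j1 * C2 (\<lambda>\<nu>. z ^ i \<nu>)"
    proof -
      have "s * ?m i ((e - 1) * b) * (s * ?m i b) = 1"
        using m[of i] s(1) by (metis mult.left_commute mult.assoc mult_1)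
      then have "inverse (s * ?m i b) = s * ?m i ((e - 1) * b)"
        by (metis inverse_unique mult.commute)
      then show ?thesis
        by (simp add: divide_inverse)
    qed
    finally show ?thesis
      using P(2)[of i] unfolding alt_shift by (metis mult.assoc)
  qed
  let ?k = "\<lambda>\<nu>. (e - 1) * j3 \<nu>"
  have "(\<Sum>l\<in>sorted_tuples n e. alt z n (nth l) j1 * alt z n (nth l) j2
            * cnj (alt z n (nth l) j3) / alt z n (nth l) j0)
      = (\<Sum>l\<in>sorted_tuples n e. A (nth l) * alt z n (nth l) ?k)"
    by (simp add: A_def cnj_alt[OF z e])
  also have "\<dots> = (\<Sum>i \<in> {..<n} \<rightarrow>\<^sub>E {..<e}. A i * (\<Prod>\<nu><n. z ^ (i \<nu> * ?k \<nu>)))"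
  proof (rule sum_sorted_tuples_alternating)
    show "A i = A i'" if "\<And>\<nu>. \<nu> < n \<Longrightarrow> i \<nu> = i' \<nu>" for i i'
      using that alt_cong[of n i i'] by (simp add: A_def)
    \<comment> \<open>Two alternants over a third: the sign enters three times, and its cube is the
      sign.\<close>
    show "A (i \<circ> \<tau>) = of_int (sign \<tau>) * A i" if "\<tau> permutes {..<n}" for i \<tau>
      by (simp add: A_def alt_permute_rows[OF that] sign_def)
    show "A i = 0" if "\<not> inj_on i {..<n}" for i
      by (simp add: A_def alt_eq_0[OF that])
  qed
  finally show ?thesis
    unfolding A_eq s_def
    using intpoly_average_in_Ints[OF intpoly_mult[OF intpoly.const intpoly_mult[OF P(1) C2(1)]] z]
    by simp
qed

section \<open>Sums over symbols, the root zeta and the entries of the matrix\<close>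

lemma sum_lists_prod:
  fixes f :: "nat \<Rightarrow> 'b \<Rightarrow> 'c::comm_semiring_1"
  assumes "\<And>\<mu>. \<mu> < r \<Longrightarrow> finite (B \<mu>)"
  shows "(\<Sum>\<xi> | length \<xi> = r \<and> (\<forall>\<mu><r. \<xi> ! \<mu> \<in> B \<mu>). \<Prod>\<mu><r. f \<mu> (\<xi> ! \<mu>)) = (\<Prod>\<mu><r. \<Sum>x\<in>B \<mu>. f \<mu> x)"
proof -
  have "(\<Prod>\<mu><r. \<Sum>x\<in>B \<mu>. f \<mu> x) = (\<Sum>g\<in>PiE {..<r} B. \<Prod>\<mu><r. f \<mu> (g \<mu>))"
    using assms by (intro prod_sum_PiE) auto
  also have "\<dots> = (\<Sum>\<xi> | length \<xi> = r \<and> (\<forall>\<mu><r. \<xi> ! \<mu> \<in> B \<mu>). \<Prod>\<mu><r. f \<mu> (\<xi> ! \<mu>))"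
  proof (rule sum.reindex_bij_witness[of _ "\<lambda>\<xi>. \<lambda>\<mu>\<in>{..<r}. \<xi> ! \<mu>" "\<lambda>g. map g [0..<r]"])
    fix g assume g: "g \<in> PiE {..<r} B"
    show "(\<lambda>\<mu>\<in>{..<r}. map g [0..<r] ! \<mu>) = g"
      by (intro ext) (simp add: PiE_arb[OF g])
    show "map g [0..<r] \<in> {\<xi>. length \<xi> = r \<and> (\<forall>\<mu><r. \<xi> ! \<mu> \<in> B \<mu>)}"
      using PiE_mem[OF g] by simp
    show "(\<Prod>\<mu><r. f \<mu> (map g [0..<r] ! \<mu>)) = (\<Prod>\<mu><r. f \<mu> (g \<mu>))"
      by (intro prod.cong) simp_all
  next
    fix \<xi> assume "\<xi> \<in> {\<xi>. length \<xi> = r \<and> (\<forall>\<mu><r. \<xi> ! \<mu> \<in> B \<mu>)}"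
    then show "map (\<lambda>\<mu>\<in>{..<r}. \<xi> ! \<mu>) [0..<r] = \<xi>" "(\<lambda>\<mu>\<in>{..<r}. \<xi> ! \<mu>) \<in> PiE {..<r} B"
      by (auto intro!: nth_equalityI)
  qed
  finally show ?thesis ..
qed

lemma zeta_power: "zeta e ^ k = cis (2 * pi * real k / real e)"
proof -
  have "zeta e = cis (2 * pi / real e)"
    by (simp add: zeta_def cis_conv_exp mult.commute)
  then show ?thesis
    by (simp add: DeMoivre mult_ac)
qed

lemma zeta_power_self: "e \<ge> 1 \<Longrightarrow> zeta e ^ e = 1"
  by (simp add: zeta_power)

text \<open>Primitivity of zeta: the real part of a power is a cosine, which equals 1 only at
  integer multiples of 2 pi.\<close>

lemma zeta_power_eq_1_iff:
  assumes "e \<ge> 1"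
  shows "zeta e ^ k = 1 \<longleftrightarrow> e dvd k"
proof
  assume "e dvd k"
  then show "zeta e ^ k = 1"
    using zeta_power_self[OF assms] by (auto simp: power_mult)
next
  assume "zeta e ^ k = 1"
  then have "Re (cis (2 * pi * real k / real e)) = Re 1"
    unfolding zeta_power by (rule arg_cong)
  then have "cos (2 * pi * real k / real e) = 1"
    by simp
  then obtain t :: int where "2 * pi * real k / real e = of_int t * 2 * pi"
    using cos_one_2pi_int by blast
  then have "real k = of_int t * real e"
    using assms by (simp add: field_simps)
  then have "int k = t * int e"
    by (metis of_int_eq_iff of_int_mult of_int_of_nat_eq)
  then show "e dvd k"
    by (metis dvd_triv_right int_dvd_int_iff)
qed

text \<open>All factors of c other than the power of sqrt e have modulus 1, and d - em = 1 makes
  that power sqrt e itself.\<close>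

lemma cconst_mult_cnj:
  assumes "d = e * m + 1"
  shows "cconst e m d * cnj (cconst e m d) = of_nat e"
proof -
  have "norm (cconst e m d) = sqrt (real e)"
    using assms by (simp add: cconst_def norm_mult norm_power norm_power_int)
  then show ?thesis
    by (simp add: complex_norm_square[symmetric] flip: of_real_power)
qed

lemma S_matrix_eq:
  "S_matrix e m Y p ws i j = cnj (cnj (cconst e m (card Y))
     * of_int (eps Y (map_of_symbol e Y p ws i)) * of_int (eps Y (map_of_symbol e Y p ws j))
     * (\<Prod>\<mu><length ws. (1 / of_real (sqrt (real e))) ^ card (fib Y p (ws ! \<mu>))
          * alt (zeta e) (card (fib Y p (ws ! \<mu>))) (nth (i ! \<mu>)) (nth (j ! \<mu>))))"
proof -
  have "(\<Sum>\<sigma> | \<sigma> permutes {..<n}. of_int (sign \<sigma>) * (\<Prod>\<nu><n. s * z ^ (i \<nu> * j (\<sigma> \<nu>))))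
      = s ^ n * (\<Sum>\<sigma> | \<sigma> permutes {..<n}. of_int (sign \<sigma>) * (\<Prod>\<nu><n. z ^ (i \<nu> * j (\<sigma> \<nu>))))"
    for s z :: complex and n i j
    unfolding sum_distrib_left by (intro sum.cong) (simp_all add: prod.distrib)
  then show ?thesis
    unfolding S_matrix_def Let_def alt_def by (simp only:)
qed

text \<open>Here \<open>\<tau>\<close> is the sorting permutation. The start \<open>a \<mu>\<close>
  may be negative, so it is represented by its residue; this provides the hypotheses of
  \<open>sum_alt_quotient_in_Ints\<close>.\<close>

lemma interval_symbol_nth_cong:
  assumes "e \<ge> 1" "\<mu> < length ws"
  shows "\<exists>\<tau>. \<tau> permutes {..<card (fib Y p (ws ! \<mu>))} \<and> (\<forall>k<card (fib Y p (ws ! \<mu>)).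
      [interval_symbol e Y p ws a ! \<mu> ! k = \<tau> k + nat (a \<mu> mod int e)] (mod e))"
proof -
  let ?n = "card (fib Y p (ws ! \<mu>))"
  define xs where "xs = map (\<lambda>k. nat ((a \<mu> + int k) mod int e)) [0..<?n]"
  have "mset (sort xs) = mset xs" by simp
  then obtain \<tau> where \<tau>: "\<tau> permutes {..<length xs}" "permute_list \<tau> xs = sort xs"
    by (rule mset_eq_permutation)
  have "[sort xs ! k = \<tau> k + nat (a \<mu> mod int e)] (mod e)" if "k < ?n" for k
  proof -
    have "sort xs ! k = permute_list \<tau> xs ! k"
      by (simp only: \<tau>(2))
    also have "\<dots> = xs ! \<tau> k"
      using \<tau>(1) that by (intro permute_list_nth) (simp_all add: xs_def)
    also have "\<dots> = nat ((a \<mu> + int (\<tau> k)) mod int e)"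
      using that \<tau>(1) permutes_lessThan[of \<tau> ?n k] by (simp add: xs_def)
    finally have "sort xs ! k = nat ((a \<mu> + int (\<tau> k)) mod int e)" .
    then have "int (sort xs ! k) = (a \<mu> + int (\<tau> k)) mod int e"
      using assms(1) by simp
    then have "[int (sort xs ! k) = int (\<tau> k + nat (a \<mu> mod int e))] (mod int e)"
      using assms(1) by (simp add: cong_def mod_simps add.commute)
    then show ?thesis
      by (simp only: cong_int_iff)
  qed
  then show ?thesis
    using \<tau>(1) assms(2) by (auto simp: interval_symbol_def xs_def)
qed

lemma eps_square: "of_int (eps Y \<psi>) * of_int (eps Y \<psi>) = (1::'b::comm_ring_1)"
  by (simp add: eps_def flip: power_add mult_2)

lemma inverse_eps: "inverse (of_int (eps Y \<psi>)) = (of_int (eps Y \<psi>) :: complex)"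
  by (intro inverse_unique eps_square)

text \<open>Conjugation undoes the one in \<open>S_matrix\<close>. The sign of \<open>\<xi>\<close>
  occurs four times and cancels, the four constants leave c times its conjugate, which is e, and the
  powers of 1/sqrt e leave one factor 1/e for each entry of the tuple.\<close>

lemma cnj_S_matrix_quotient:
  fixes Y :: "'a::linorder set" and p :: "'a \<Rightarrow> nat" and ws :: "nat list"
    and e m :: nat and n :: "nat \<Rightarrow> nat" and E :: "nat list list \<Rightarrow> complex"
    and D :: "nat list list \<Rightarrow> nat list list \<Rightarrow> nat \<Rightarrow> complex" and S :: "nat list list \<Rightarrow> nat list list \<Rightarrow> complex"
    and \<xi> \<xi>0 \<xi>1 \<xi>2 \<xi>3 :: "nat list list"
  assumes "e \<ge> 1" "card Y = e * m + 1"
  defines "n \<equiv> \<lambda>\<mu>. card (fib Y p (ws ! \<mu>))"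
    and "E \<equiv> \<lambda>\<xi>. of_int (eps Y (map_of_symbol e Y p ws \<xi>))"
    and "D \<equiv> \<lambda>\<xi> \<xi>' \<mu>. alt (zeta e) (n \<mu>) (nth (\<xi> ! \<mu>)) (nth (\<xi>' ! \<mu>))"
    and "S \<equiv> S_matrix e m Y p ws"
  shows "cnj (S \<xi> \<xi>1 * S \<xi> \<xi>2 * cnj (S \<xi> \<xi>3) / S \<xi> \<xi>0) =
    E \<xi>0 * E \<xi>1 * E \<xi>2 * E \<xi>3 * of_nat e *
      (\<Prod>\<mu><length ws. D \<xi> \<xi>1 \<mu> * D \<xi> \<xi>2 \<mu> * cnj (D \<xi> \<xi>3 \<mu>) / D \<xi> \<xi>0 \<mu> / of_nat e ^ n \<mu>)"
proof -
  define c where "c = cconst e m (card Y)"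
  define s :: complex where "s = 1 / of_real (sqrt (real e))"
  define P where "P \<xi>' = (\<Prod>\<mu><length ws. s ^ n \<mu> * D \<xi> \<xi>' \<mu>)" for \<xi>'
  have S: "S \<xi> \<xi>' = cnj (cnj c * E \<xi> * E \<xi>' * P \<xi>')" for \<xi>'
    unfolding S_def S_matrix_eq c_def E_def P_def D_def n_def s_def ..
  have cE: "cnj (E \<xi>) = E \<xi>" "E \<xi> * E \<xi> = 1" "inverse (E \<xi>) = E \<xi>" for \<xi>
    by (simp_all add: E_def eps_square inverse_eps)
  have cc: "c * cnj c = of_nat e"
    unfolding c_def using assms(2) by (rule cconst_mult_cnj)
  then have "c \<noteq> 0"
    using assms(1) by auto
  then have cinv: "cnj c * inverse (cnj c) = 1"
    by simp
  have ss: "s * s = 1 / of_nat e"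
    by (simp add: s_def flip: of_real_mult)
  have sn: "s ^ n \<mu> * s ^ n \<mu> = 1 / of_nat e ^ n \<mu>" for \<mu>
    by (simp add: power_mult_distrib[symmetric] ss power_one_over)
  have s0: "s \<noteq> 0" "cnj s = s"
    using assms(1) by (simp_all add: s_def)
  have "P \<xi>1 * P \<xi>2 * cnj (P \<xi>3) / P \<xi>0 = (\<Prod>\<mu><length ws. D \<xi> \<xi>1 \<mu> * D \<xi> \<xi>2 \<mu> * cnj (D \<xi> \<xi>3 \<mu>) / D \<xi> \<xi>0 \<mu> / of_nat e ^ n \<mu>)"
    unfolding P_def cnj_prod prod.distrib[symmetric] prod_dividef[symmetric]
  proof (rule prod.cong)
    fix \<mu>
    have "(s ^ n \<mu> * x) * (s ^ n \<mu> * y) * cnj (s ^ n \<mu> * w) / (s ^ n \<mu> * v) = (s ^ n \<mu> * s ^ n \<mu>) * (x * y * cnj w / v)"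
      for x y w v
      using s0 by simp
    then show "(s ^ n \<mu> * D \<xi> \<xi>1 \<mu>) * (s ^ n \<mu> * D \<xi> \<xi>2 \<mu>) * cnj (s ^ n \<mu> * D \<xi> \<xi>3 \<mu>) / (s ^ n \<mu> * D \<xi> \<xi>0 \<mu>)
      = D \<xi> \<xi>1 \<mu> * D \<xi> \<xi>2 \<mu> * cnj (D \<xi> \<xi>3 \<mu>) / D \<xi> \<xi>0 \<mu> / of_nat e ^ n \<mu>"
      unfolding sn by simp
  qed simp
  \<comment> \<open>Inversion distributes over products also when alternants in
    \<open>P \<xi>0\<close> are 0, and a sign is its own inverse. The factors are grouped so that
    each group collapses to a known constant.\<close>
  moreover have "cnj (S \<xi> \<xi>1 * S \<xi> \<xi>2 * cnj (S \<xi> \<xi>3) / S \<xi> \<xi>0) =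
    (cnj c * inverse (cnj c)) * (c * cnj c) * (E \<xi> * E \<xi>) * (E \<xi> * E \<xi>)
      * (E \<xi>0 * E \<xi>1 * E \<xi>2 * E \<xi>3) * (P \<xi>1 * P \<xi>2 * cnj (P \<xi>3) / P \<xi>0)"
    by (simp only: S divide_inverse complex_cnj_mult complex_cnj_inverse complex_cnj_cnj
        inverse_mult_distrib cE(1,3) mult_ac)
  ultimately show ?thesis
    unfolding cinv cc cE by (simp only: mult_ac mult_1)
qed

text \<open>A symbol is an independent choice of one increasing tuple per fibre, so the sum factors.
  The congruence defining E' would couple the fibres, which is why the sum runs over all of
  E.\<close>

lemma sum_symbols:
  "(\<Sum>\<xi>\<in>symbols e Y p ws. \<Prod>\<mu><length ws. f \<mu> (\<xi> ! \<mu>)) =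
   (\<Prod>\<mu><length ws. \<Sum>l\<in>sorted_tuples (card (fib Y p (ws ! \<mu>))) e. (f \<mu> l :: complex))"
proof -
  have "symbols e Y p ws = {\<xi>. length \<xi> = length ws \<and>
      (\<forall>\<mu><length ws. \<xi> ! \<mu> \<in> sorted_tuples (card (fib Y p (ws ! \<mu>))) e)}"
    by (auto simp: symbols_def sorted_tuples_def)
  then show ?thesis
    by (simp only:) (rule sum_lists_prod, rule finite_sorted_tuples)
qed

lemma finite_symbols: "finite (symbols e Y p ws)"
proof -
  have "set \<xi> \<subseteq> (\<Union>\<mu><length ws. sorted_tuples (card (fib Y p (ws ! \<mu>))) e)" if "\<xi> \<in> symbols e Y p ws" for \<xi>
  proof
    fix l assume "l \<in> set \<xi>"
    then obtain \<mu> where "\<mu> < length \<xi>" "l = \<xi> ! \<mu>"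
      by (metis in_set_conv_nth)
    then show "l \<in> (\<Union>\<mu><length ws. sorted_tuples (card (fib Y p (ws ! \<mu>))) e)"
      using that by (auto simp: symbols_def sorted_tuples_def)
  qed
  then show ?thesis
    by (intro finite_subset[OF _ finite_lists_length_eq[of "\<Union>\<mu><length ws. sorted_tuples (card (fib Y p (ws ! \<mu>))) e" "length ws"]])
       (auto simp: symbols_def finite_sorted_tuples)
qed

text \<open>The square of the power with exponent \<open>e choose 2\<close> is zeta^(e(e-1)) = 1, so
  that power is a sign. Hence the residue chosen in the definition of E' contributes only integer
  constants to the character sum.\<close>

lemma zeta_power_choose_in_Ints:
  assumes "e \<ge> 1"
  shows "zeta e ^ (k * (e choose 2)) \<in> \<int>"
proof -
  have "even (e * (e - 1))"
    by (cases e) auto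
  then have "e * (e - 1) = 2 * (e choose 2)"
    by (simp add: choose_two)
  then have "(zeta e ^ (e choose 2))\<^sup>2 = (zeta e ^ e) ^ (e - 1)"
    by (metis power_mult mult.commute)
  then have "(zeta e ^ (e choose 2))\<^sup>2 = 1"
    using zeta_power_self[OF assms] by simp
  then have "zeta e ^ (e choose 2) \<in> \<int>"
    by (auto simp: power2_eq_1_iff)
  then show ?thesis
    by (metis Ints_power mult.commute power_mult)
qed

section \<open>Assembly of the structure constants\<close>

theorem proposition5p1:
  fixes e m :: nat
    and Y :: "'a::linorder set"
    and p :: "'a \<Rightarrow> nat"
    and ws :: "nat list"
    and a :: "nat \<Rightarrow> int"
    and \<xi>1 \<xi>2 \<xi>3 :: "nat list list"
  assumes "e \<ge> 1"
    and "finite Y" and "card Y = e * m + 1"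
    and "\<And>w. card (fib Y p w) \<le> e"
    and "distinct ws" and "set ws = p ` Y"
    and "interval_symbol e Y p ws a \<in> symbols' e m Y p ws"
    and "\<xi>1 \<in> symbols' e m Y p ws" and "\<xi>2 \<in> symbols' e m Y p ws" and "\<xi>3 \<in> symbols' e m Y p ws"
  shows "struct_const e m Y p ws (interval_symbol e Y p ws a) \<xi>1 \<xi>2 \<xi>3 \<in> \<int>"
proof -
  define \<xi>0 where "\<xi>0 = interval_symbol e Y p ws a"
  define r where "r = length ws"
  define n where "n \<mu> = card (fib Y p (ws ! \<mu>))" for \<mu>
  define z where "z = zeta e"
  define q where "q = m * (e choose 2)"
  define w where "w \<xi> = (\<Sum>\<mu><r. \<Sum>\<nu><n \<mu>. \<xi> ! \<mu> ! \<nu>)" for \<xi> :: "nat list list"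
  define E :: complex where "E = of_int (eps Y (map_of_symbol e Y p ws \<xi>0)) * of_int (eps Y (map_of_symbol e Y p ws \<xi>1))
    * of_int (eps Y (map_of_symbol e Y p ws \<xi>2)) * of_int (eps Y (map_of_symbol e Y p ws \<xi>3))"
  define K where "K \<mu> l = alt z (n \<mu>) (nth l) (nth (\<xi>1 ! \<mu>)) * alt z (n \<mu>) (nth l) (nth (\<xi>2 ! \<mu>))
    * cnj (alt z (n \<mu>) (nth l) (nth (\<xi>3 ! \<mu>))) / alt z (n \<mu>) (nth l) (nth (\<xi>0 ! \<mu>)) / of_nat e ^ n \<mu>" for \<mu> l
  have z: "z ^ e = 1"
    unfolding z_def by (rule zeta_power_self[OF assms(1)])
  have symbols': "symbols' e m Y p ws = {\<xi> \<in> symbols e Y p ws. [w \<xi> = q] (mod e)}"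
    by (simp add: symbols'_def w_def q_def n_def r_def)
  \<comment> \<open>The factor $e = |c|^2$ is what makes the sum over \<open>E'\<close> a sum of characters without denominators.\<close>
  have filter: "(if [w \<xi> = q] (mod e) then of_nat e else 0) = (\<Sum>t<e. z ^ (t * (w \<xi> + (e - 1) * q)))" for \<xi>
  proof -
    \<comment> \<open>Adding \<open>(e - 1) * q\<close> stands for subtracting \<open>q\<close> and
      keeps the exponents natural.\<close>
    have "[w \<xi> = q] (mod e) \<longleftrightarrow> [w \<xi> + (e - 1) * q = q + (e - 1) * q] (mod e)"
      by (simp only: cong_add_rcancel_nat)
    also have "q + (e - 1) * q = e * q"
      using assms(1) by (cases e) simp_all
    also have "[w \<xi> + (e - 1) * q = e * q] (mod e) \<longleftrightarrow> e dvd w \<xi> + (e - 1) * q"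
      by (simp add: cong_def dvd_eq_mod_eq_0)
    finally show ?thesis
      using sum_powers_root_of_unity[OF z] zeta_power_eq_1_iff[OF assms(1)] by (simp add: z_def)
  qed
  have shifted: "(\<Prod>\<mu><r. z ^ (t * (\<Sum>\<nu><n \<mu>. \<xi> ! \<mu> ! \<nu>)) * K \<mu> (\<xi> ! \<mu>)) = z ^ (t * w \<xi>) * (\<Prod>\<mu><r. K \<mu> (\<xi> ! \<mu>))" for t \<xi>
    by (simp add: prod.distrib w_def sum_distrib_left power_sum)
  have integral: "(\<Sum>l\<in>sorted_tuples (n \<mu>) e. z ^ (t * (\<Sum>\<nu><n \<mu>. l ! \<nu>)) * K \<mu> l) \<in> \<int>" if "\<mu> < r" for \<mu> t
  proof -
    obtain \<tau> where \<tau>: "\<tau> permutes {..<n \<mu>}" "\<And>k. k < n \<mu> \<Longrightarrow> [\<xi>0 ! \<mu> ! k = \<tau> k + nat (a \<mu> mod int e)] (mod e)"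
      using interval_symbol_nth_cong[OF assms(1), of \<mu> ws Y p a] \<open>\<mu> < r\<close> unfolding \<xi>0_def n_def r_def by blast
    \<comment> \<open>The twist by \<open>t\<close> becomes a shift of the exponents
      \<open>\<xi>1 ! \<mu>\<close>, which are arbitrary in
      \<open>sum_alt_quotient_in_Ints\<close>.\<close>
    have shift: "z ^ (t * (\<Sum>\<nu><n \<mu>. l ! \<nu>)) * alt z (n \<mu>) (nth l) (nth (\<xi>1 ! \<mu>))
        = alt z (n \<mu>) (nth l) (\<lambda>k. \<xi>1 ! \<mu> ! k + t)" for l
      unfolding alt_shift by (simp add: sum_distrib_left power_sum mult.commute)
    have "z ^ (t * (\<Sum>\<nu><n \<mu>. l ! \<nu>)) * K \<mu> l = alt z (n \<mu>) (nth l) (\<lambda>k. \<xi>1 ! \<mu> ! k + t) * alt z (n \<mu>) (nth l) (nth (\<xi>2 ! \<mu>))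
    * cnj (alt z (n \<mu>) (nth l) (nth (\<xi>3 ! \<mu>))) / alt z (n \<mu>) (nth l) (nth (\<xi>0 ! \<mu>)) / of_nat e ^ n \<mu>" for l
      unfolding K_def by (simp only: times_divide_eq_right mult.assoc[symmetric] shift)
    then show ?thesis
      using sum_alt_quotient_in_Ints[OF z assms(1) \<tau>] by (simp only: sum_divide_distrib)
  qed
  \<comment> \<open>It suffices to treat the conjugate, since integers are real.\<close>
  have "cnj (struct_const e m Y p ws \<xi>0 \<xi>1 \<xi>2 \<xi>3) =
      (\<Sum>\<xi>\<in>symbols' e m Y p ws. E * of_nat e * (\<Prod>\<mu><r. K \<mu> (\<xi> ! \<mu>)))"
    unfolding struct_const_def cnj_sum cnj_S_matrix_quotient[OF assms(1,3)] E_def K_def n_def z_def r_def ..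
  also have "\<dots> = (\<Sum>\<xi>\<in>symbols e Y p ws. E * (if [w \<xi> = q] (mod e) then of_nat e else 0) * (\<Prod>\<mu><r. K \<mu> (\<xi> ! \<mu>)))"
    unfolding symbols' by (subst sum.inter_filter[OF finite_symbols]) (auto intro: sum.cong)
  \<comment> \<open>With characters in place of the congruence, each summand is a product over the
    fibres times a constant depending only on \<open>t\<close>.\<close>
  also have "\<dots> = (\<Sum>\<xi>\<in>symbols e Y p ws. \<Sum>t<e. E * z ^ (t * (e - 1) * q) * (\<Prod>\<mu><r. z ^ (t * (\<Sum>\<nu><n \<mu>. \<xi> ! \<mu> ! \<nu>)) * K \<mu> (\<xi> ! \<mu>)))"
    unfolding filter shifted
    by (simp add: sum_distrib_left sum_distrib_right distrib_left power_add mult_ac)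
  also have "\<dots> = (\<Sum>t<e. E * z ^ (t * (e - 1) * q) * (\<Sum>\<xi>\<in>symbols e Y p ws. \<Prod>\<mu><r. z ^ (t * (\<Sum>\<nu><n \<mu>. \<xi> ! \<mu> ! \<nu>)) * K \<mu> (\<xi> ! \<mu>)))"
    unfolding sum_distrib_left by (rule sum.swap)
  also have "\<dots> = (\<Sum>t<e. E * z ^ (t * (e - 1) * q) * (\<Prod>\<mu><r. \<Sum>l\<in>sorted_tuples (n \<mu>) e. z ^ (t * (\<Sum>\<nu><n \<mu>. l ! \<nu>)) * K \<mu> l))"
    unfolding r_def n_def by (subst sum_symbols) (rule refl)
  also have "\<dots> \<in> \<int>"
  proof (rule Ints_sum, intro Ints_mult Ints_prod)
    show "E \<in> \<int>"
      unfolding E_def by (intro Ints_mult Ints_of_int)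
    show "z ^ (t * (e - 1) * q) \<in> \<int>" for t
      unfolding z_def q_def mult.assoc[symmetric] by (rule zeta_power_choose_in_Ints[OF assms(1)])
  qed (use integral in auto)
  finally show ?thesis
    unfolding \<xi>0_def by (metis Ints_cases Ints_of_int complex_cnj_cnj complex_cnj_of_int)
qed

end
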